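(* Let $W^B$ be a channel from a finite set $\mathcal X$ to a finite set $\mathcal Y$ and $W^E$ a channel from $\mathcal X$ to a finite set $\mathcal Z$, and consider their $n$-fold memoryless extensions $W^{B,n},W^{E,n}$. For any nonnegative reals $R,R'$ and any probability distribution $p$ on $\mathcal X$, there exists a sequence $\{\Phi_n\}$ of wire-tap codes for $(W^{B,n},W^{E,n})$ such that $\lim_n\frac1n\log|\Phi_n|=R$ and $$\liminf_n-\tfrac1n\log\epsilon_B(\Phi_n)\ge\max_{0\le s\le1}\{-\phi(s|W^B,p)-s(R+R')\},$$ $$\liminf_n-\tfrac1n\log I_E(\Phi_n)\ge\max_{-1/2\le t\le0}\{-\phi(t|W^E,p)-tR'\},$$ $$\liminf_n-\tfrac1n\log d_E(\Phi_n)\ge\max_{0\le s\le1}\frac{-\psi(s|W^E,p)+sR'}{1+s},$$ $$\liminf_n-\tfrac1n\log d_E(\Phi_n)\ge\tfrac12\max_{-1/2\le t\le0}\{-\phi(t|W^E,p)-tR'\}.$$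
   Context: A channel $W$ assigns to each input $x$ a distribution $W_x$ on the output set; $W_p(y)=\sum_xp(x)W_x(y)$; the $n$-fold memoryless extension is $W^n_{x^n}(y^n)=\prod_iW_{x_i}(y_i)$. A wire-tap code $\Phi=(M,\{Q_i\},\{\mathcal D_i\})$ for $(W^B,W^E)$: input distributions $Q_1,\dots,Q_M$ and pairwise disjoint subsets $\mathcal D_i$ of the main receiver's output set; $|\Phi|=M$, $\epsilon_B(\Phi)=\frac1M\sum_iW^B_{Q_i}(\mathcal D_i^c)$, $I_E(\Phi)=\sum_i\frac1MD(W^E_{Q_i}\|W^E_\Phi)$ with $W^E_\Phi=\frac1M\sum_iW^E_{Q_i}$ and $D(a\|b)=\sum a\log(a/b)$, $d_E(\Phi)=\frac1{M(M-1)}\sum_{i\ne j}\sum_z|W^E_{Q_i}(z)-W^E_{Q_j}(z)|$. Functions: $\phi(t|W,p):=\log\sum_y\big(\sum_xp(x)W_x(y)^{1/(1+t)}\big)^{1+t}$; $\psi(s|W,p):=\log\sum_xp(x)\sum_yW_x(y)^{1+s}W_p(y)^{-s}$. *)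

theory Defs
  imports "HOL-Analysis.Analysis"
begin

definition channel :: "('a::finite \<Rightarrow> 'b::finite \<Rightarrow> real) \<Rightarrow> bool" where
  "channel W \<longleftrightarrow> (\<forall>x y. 0 \<le> W x y) \<and> (\<forall>x. (\<Sum>y\<in>UNIV. W x y) = 1)"

definition distr :: "('a::finite \<Rightarrow> real) \<Rightarrow> bool" where
  "distr p \<longleftrightarrow> (\<forall>x. 0 \<le> p x) \<and> (\<Sum>x\<in>UNIV. p x) = 1"

definition words :: "nat \<Rightarrow> 'a list set" where
  "words n = {xs. length xs = n}"

definition chan_ext :: "('a \<Rightarrow> 'b \<Rightarrow> real) \<Rightarrow> nat \<Rightarrow> 'a list \<Rightarrow> 'b list \<Rightarrow> real" where
  "chan_ext W n xs ys =
     (if length xs = n \<and> length ys = n then (\<Prod>i<n. W (xs ! i) (ys ! i)) else 0)"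

definition out_ext :: "('a::finite \<Rightarrow> 'b \<Rightarrow> real) \<Rightarrow> nat \<Rightarrow> ('a list \<Rightarrow> real) \<Rightarrow> 'b list \<Rightarrow> real" where
  "out_ext W n Q ys = (\<Sum>xs\<in>words n. Q xs * chan_ext W n xs ys)"

text \<open>A wire-tap code: M messages, input distributions Q_i, decoding sets D_i (i < M).\<close>
record ('a, 'b) wtcode =
  wc_M :: nat
  wc_Q :: "nat \<Rightarrow> 'a list \<Rightarrow> real"
  wc_D :: "nat \<Rightarrow> 'b list set"

definition is_wtcode :: "nat \<Rightarrow> ('a::finite, 'b::finite) wtcode \<Rightarrow> bool" where
  "is_wtcode n \<Phi> \<longleftrightarrow> 1 \<le> wc_M \<Phi> \<and>
     (\<forall>i<wc_M \<Phi>. (\<forall>xs. 0 \<le> wc_Q \<Phi> i xs) \<and> (\<forall>xs. xs \<notin> words n \<longrightarrow> wc_Q \<Phi> i xs = 0)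
        \<and> (\<Sum>xs\<in>words n. wc_Q \<Phi> i xs) = 1) \<and>
     (\<forall>i<wc_M \<Phi>. wc_D \<Phi> i \<subseteq> words n) \<and>
     (\<forall>i<wc_M \<Phi>. \<forall>j<wc_M \<Phi>. i \<noteq> j \<longrightarrow> wc_D \<Phi> i \<inter> wc_D \<Phi> j = {})"

definition eps_B :: "('a::finite \<Rightarrow> 'b::finite \<Rightarrow> real) \<Rightarrow> nat \<Rightarrow> ('a, 'b) wtcode \<Rightarrow> real" where
  "eps_B WB n \<Phi> = (1 / real (wc_M \<Phi>)) *
     (\<Sum>i<wc_M \<Phi>. \<Sum>ys\<in>words n - wc_D \<Phi> i. out_ext WB n (wc_Q \<Phi> i) ys)"

definition KL :: "'b set \<Rightarrow> ('b \<Rightarrow> real) \<Rightarrow> ('b \<Rightarrow> real) \<Rightarrow> real" where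
  "KL S a b = (\<Sum>y\<in>S. a y * ln (a y / b y))"

definition avg_out :: "('a::finite \<Rightarrow> 'c \<Rightarrow> real) \<Rightarrow> nat \<Rightarrow> ('a, 'b) wtcode \<Rightarrow> 'c list \<Rightarrow> real" where
  "avg_out WE n \<Phi> zs = (1 / real (wc_M \<Phi>)) * (\<Sum>i<wc_M \<Phi>. out_ext WE n (wc_Q \<Phi> i) zs)"

definition I_E :: "('a::finite \<Rightarrow> 'c::finite \<Rightarrow> real) \<Rightarrow> nat \<Rightarrow> ('a, 'b) wtcode \<Rightarrow> real" where
  "I_E WE n \<Phi> = (\<Sum>i<wc_M \<Phi>. (1 / real (wc_M \<Phi>)) *
      KL (words n) (out_ext WE n (wc_Q \<Phi> i)) (avg_out WE n \<Phi>))"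

definition d_E :: "('a::finite \<Rightarrow> 'c::finite \<Rightarrow> real) \<Rightarrow> nat \<Rightarrow> ('a, 'b) wtcode \<Rightarrow> real" where
  "d_E WE n \<Phi> = (1 / (real (wc_M \<Phi>) * (real (wc_M \<Phi>) - 1))) *
      (\<Sum>i<wc_M \<Phi>. \<Sum>j\<in>{..<wc_M \<Phi>} - {i}. \<Sum>zs\<in>words n.
          \<bar>out_ext WE n (wc_Q \<Phi> i) zs - out_ext WE n (wc_Q \<Phi> j) zs\<bar>)"

definition phi_fn :: "real \<Rightarrow> ('a::finite \<Rightarrow> 'b::finite \<Rightarrow> real) \<Rightarrow> ('a \<Rightarrow> real) \<Rightarrow> real" where
  "phi_fn t W p = ln (\<Sum>y\<in>UNIV. (\<Sum>x\<in>UNIV. p x * W x y powr (1 / (1 + t))) powr (1 + t))"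

definition out1 :: "('a::finite \<Rightarrow> 'b \<Rightarrow> real) \<Rightarrow> ('a \<Rightarrow> real) \<Rightarrow> 'b \<Rightarrow> real" where
  "out1 W p y = (\<Sum>x\<in>UNIV. p x * W x y)"

definition psi_fn :: "real \<Rightarrow> ('a::finite \<Rightarrow> 'b::finite \<Rightarrow> real) \<Rightarrow> ('a \<Rightarrow> real) \<Rightarrow> real" where
  "psi_fn s W p = ln (\<Sum>x\<in>UNIV. p x * (\<Sum>y\<in>UNIV. W x y powr (1 + s) * out1 W p y powr (- s)))"

definition exprate :: "nat \<Rightarrow> real \<Rightarrow> ereal" where
  "exprate n a = (if a = 0 then PInfty else ereal (- ln a / real n))"

end

theory Submission
  imports Defs "HOL-Real_Asymp.Real_Asymp"
begin

text \<open>
  Random coding with \<open>M L\<close> independent codewords of law \<open>p^n\<close>, where \<open>M\<close> is about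
  \<open>exp (n R)\<close> and \<open>L\<close> about \<open>exp (n R')\<close>; message \<open>i\<close> is sent by a uniformly chosen member
  of its own block of \<open>L\<close> codewords. Reliability is Gallager's bound for maximum likelihood
  decoding of all \<open>M L\<close> codewords.

  All three secrecy bounds come from a single quantity, the average \<open>\<delta>\<close> over \<open>i\<close> of the
  \<open>L1\<close> distance between the eavesdropper's output for message \<open>i\<close> and the output of \<open>p^n\<close>.
  Truncation at a suitable level bounds its mean by \<open>3 L^t exp (n \<phi>(t))\<close>.
  The distinguishability \<open>d_E\<close> is at most \<open>2 \<delta>\<close>, and since each message's output is at most
  \<open>M\<close> times the average output, \<open>I_E \<le> (1 + ln M) d_E\<close>, which loses only a factor linear
  in \<open>n\<close>. The bound with \<open>\<psi>\<close> follows from \<open>\<phi>(- s / (1 + s)) \<le> \<psi>(s) / (1 + s)\<close>, and the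
  one with the factor \<open>1/2\<close> is weaker because the maximum is nonnegative (take \<open>t = 0\<close>).
\<close>

section \<open>Concavity of powers with exponent between 0 and 1\<close>

text \<open>The right-hand side is the tangent at \<open>v\<close> of the concave function
  \<open>u powr r\<close>. It comes from Young's inequality with weights \<open>r\<close> and
  \<open>1 - r\<close>, multiplied by \<open>v powr (r - 1)\<close>.\<close>

lemma powr_le_tangent:
  fixes r u v :: real
  assumes "0 \<le> r" "r \<le> 1" "0 \<le> u" "0 < v"
  shows "u powr r \<le> r * u * v powr (r - 1) + (1 - r) * v powr r"
proof (cases "u = 0")
  case True
  then show ?thesis using assms by simp
next
  case False
  have "u powr r = (u powr r * v powr (1 - r)) * v powr (r - 1)"
    using assms by (simp add: mult.assoc flip: powr_add)
  also have "\<dots> \<le> (r * u + (1 - r) * v) * v powr (r - 1)"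
    using assms False by (intro mult_right_mono Youngs_inequality_0) auto
  also have "\<dots> = r * u * v powr (r - 1) + (1 - r) * v powr r"
    using assms by (simp add: algebra_simps powr_mult_base)
  finally show ?thesis .
qed

text \<open>Jensen's inequality: averaging the tangent at the mean gives exactly the value at the
  mean. Positivity of the mean makes it an admissible point of tangency.\<close>

lemma weighted_sum_powr_le:
  fixes q u :: "'b \<Rightarrow> real"
  assumes "0 \<le> r" "r \<le> 1" "\<And>y. y \<in> Y \<Longrightarrow> 0 \<le> q y" "\<And>y. y \<in> Y \<Longrightarrow> 0 \<le> u y"
    and "(\<Sum>y\<in>Y. q y) = 1" and "0 < (\<Sum>y\<in>Y. q y * u y)"
  shows "(\<Sum>y\<in>Y. q y * u y powr r) \<le> (\<Sum>y\<in>Y. q y * u y) powr r"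
proof -
  define H where "H = (\<Sum>y\<in>Y. q y * u y)"
  have "(\<Sum>y\<in>Y. q y * u y powr r)
      \<le> (\<Sum>y\<in>Y. q y * (r * u y * H powr (r - 1) + (1 - r) * H powr r))"
    using assms by (intro sum_mono mult_left_mono powr_le_tangent) (auto simp: H_def)
  also have "\<dots> = r * H powr (r - 1) * (\<Sum>y\<in>Y. q y * u y) + (1 - r) * H powr r * (\<Sum>y\<in>Y. q y)"
    by (simp add: sum_distrib_left flip: sum.distrib) (simp add: algebra_simps)
  also have "\<dots> = H powr r"
    using assms(5,6) by (simp add: H_def[symmetric] algebra_simps powr_mult_base)
  finally show ?thesis by (simp add: H_def)
qed

section \<open>Independent random codebooks\<close>

locale codebook =
  fixes A :: "'x set" and P :: "'x \<Rightarrow> real" and N :: nat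
  assumes finite_A: "finite A" and P_nonneg: "\<And>x. x \<in> A \<Longrightarrow> 0 \<le> P x"
    and sum_P: "(\<Sum>x\<in>A. P x) = 1"
begin

text \<open>Expectations are finite weighted sums, so no measure theory enters. Codebooks are
  extensional functions, so each is counted once and sums of products factor.\<close>

definition books :: "(nat \<Rightarrow> 'x) set" where
  "books = PiE {..<N} (\<lambda>_. A)"

definition weight :: "(nat \<Rightarrow> 'x) \<Rightarrow> real" where
  "weight c = (\<Prod>k<N. P (c k))"

definition mean :: "('x \<Rightarrow> real) \<Rightarrow> real" where
  "mean f = (\<Sum>x\<in>A. P x * f x)"

definition expect :: "((nat \<Rightarrow> 'x) \<Rightarrow> real) \<Rightarrow> real" where
  "expect F = (\<Sum>c\<in>books. weight c * F c)"

lemma finite_books: "finite books"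
  unfolding books_def using finite_A by (intro finite_PiE) auto

lemma books_mem: "c \<in> books \<Longrightarrow> k < N \<Longrightarrow> c k \<in> A"
  unfolding books_def by auto

lemma weight_nonneg: "c \<in> books \<Longrightarrow> 0 \<le> weight c"
  unfolding weight_def using books_mem P_nonneg by (intro prod_nonneg) auto

lemma mean_nonneg: "(\<And>x. x \<in> A \<Longrightarrow> 0 \<le> f x) \<Longrightarrow> 0 \<le> mean f"
  unfolding mean_def using P_nonneg by (intro sum_nonneg) auto

lemma mean_mono: "(\<And>x. x \<in> A \<Longrightarrow> f x \<le> g x) \<Longrightarrow> mean f \<le> mean g"
  unfolding mean_def using P_nonneg by (intro sum_mono mult_left_mono) auto

lemma mean_add: "mean (\<lambda>x. f x + g x) = mean f + mean g"
  unfolding mean_def by (simp add: sum.distrib algebra_simps)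

lemma mean_cmult: "mean (\<lambda>x. a * f x) = a * mean f"
  unfolding mean_def by (simp add: sum_distrib_left algebra_simps)

lemma mean_const: "mean (\<lambda>x. a) = a"
  unfolding mean_def using sum_P by (simp flip: sum_distrib_right)

lemma expect_mono: "(\<And>c. c \<in> books \<Longrightarrow> F c \<le> G c) \<Longrightarrow> expect F \<le> expect G"
  unfolding expect_def using weight_nonneg by (intro sum_mono mult_left_mono) auto

lemma expect_add: "expect (\<lambda>c. F c + G c) = expect F + expect G"
  unfolding expect_def by (simp add: sum.distrib algebra_simps)

lemma expect_cmult: "expect (\<lambda>c. a * F c) = a * expect F"
  unfolding expect_def by (simp add: sum_distrib_left algebra_simps)

lemma expect_divide: "expect (\<lambda>c. F c / a) = expect F / a"
  using expect_cmult[of "1 / a" F] by simp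

lemma expect_sum: "expect (\<lambda>c. \<Sum>i\<in>I. F i c) = (\<Sum>i\<in>I. expect (F i))"
  unfolding expect_def by (simp add: sum_distrib_left) (rule sum.swap)

text \<open>Independence of the codewords. The formulas for one and for two codewords follow by
  putting the constant 1 at all other positions.\<close>

lemma expect_prod: "expect (\<lambda>c. \<Prod>k<N. f k (c k)) = (\<Prod>k<N. mean (f k))"
  unfolding expect_def mean_def weight_def books_def
  using finite_A by (simp add: prod_sum_PiE flip: prod.distrib)

lemma expect_const: "expect (\<lambda>_. a) = a"
proof -
  have "expect (\<lambda>_. 1) = 1"
    using expect_prod[of "\<lambda>_ _. 1"] by (simp add: mean_const)
  then show ?thesis using expect_cmult[of a "\<lambda>_. 1"] by simp
qed

lemma expect_one:
  assumes "k < N"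
  shows "expect (\<lambda>c. f (c k)) = mean f"
proof -
  have "expect (\<lambda>c. f (c k)) = expect (\<lambda>c. \<Prod>l<N. (if l = k then f else (\<lambda>_. 1)) (c l))"
    using assms by (simp add: if_distribR prod.delta)
  also have "\<dots> = (\<Prod>l<N. if l = k then mean f else 1)"
    by (subst expect_prod, rule prod.cong) (auto simp: mean_const)
  finally show ?thesis using assms by simp
qed

lemma expect_two:
  assumes "k < N" "l < N" "k \<noteq> l"
  shows "expect (\<lambda>c. f (c k) * g (c l)) = mean f * mean g"
proof -
  have 1: "(if i = k then f x else 1) * (if i = l then g x else 1)
      = (if i = k then f else if i = l then g else (\<lambda>_. 1)) x" for i x
    using assms by auto
  have "expect (\<lambda>c. f (c k) * g (c l))
      = expect (\<lambda>c. \<Prod>i<N. (if i = k then f else if i = l then g else (\<lambda>_. 1)) (c i))"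
    using assms by (simp add: prod.delta prod.distrib flip: 1)
  also have "\<dots> = (\<Prod>i<N. (if i = k then mean f else 1) * (if i = l then mean g else 1))"
    using assms by (subst expect_prod, intro prod.cong) (auto simp: mean_const)
  finally show ?thesis using assms by (simp add: prod.distrib)
qed

text \<open>A single codebook must serve both criteria. The two normalised quantities sum to
  something of expectation at most 2, and both are nonnegative, so a codebook where the sum is at
  most 2 is good for each.\<close>

lemma exists_good_book:
  assumes F: "\<And>c. c \<in> books \<Longrightarrow> 0 \<le> F c" and G: "\<And>c. c \<in> books \<Longrightarrow> 0 \<le> G c"
  obtains c where "c \<in> books" "F c \<le> 2 * expect F" "G c \<le> 2 * expect G"
proof -
  define Z where "Z c = F c / expect F + G c / expect G" for c
  have F0: "0 \<le> expect F" and G0: "0 \<le> expect G"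
    using expect_mono[of "\<lambda>_. 0" F] expect_mono[of "\<lambda>_. 0" G] F G by (auto simp: expect_const)
  have EZ: "expect Z \<le> 2"
    using expect_cmult[of "1 / expect F" F] expect_cmult[of "1 / expect G" G] F0 G0
    unfolding Z_def expect_add by (simp split: if_splits)
  \<comment> \<open>A vanishing expectation makes its quotient 0 by the convention on division, so
    \<open>Z\<close> says nothing there. Positive weight covers this case: it forces the quantity
    itself to vanish at \<open>c\<close>.\<close>
  have "\<exists>c\<in>books. 0 < weight c \<and> Z c \<le> 2"
  proof (rule ccontr)
    assume *: "\<not> ?thesis"
    have le: "weight c * 2 \<le> weight c * Z c" if "c \<in> books" for c
      using * that weight_nonneg[OF that] by (cases "weight c = 0") auto
    have "(\<Sum>c\<in>books. weight c) = 1"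
      using expect_const[of 1] by (simp add: expect_def)
    then obtain c where c: "c \<in> books" "weight c \<noteq> 0"
      by (metis sum.neutral zero_neq_one)
    have "expect (\<lambda>_. 2) < expect Z"
      unfolding expect_def using le c * weight_nonneg[OF c(1)] finite_books
      by (intro sum_strict_mono_ex1) (auto intro!: bexI[of _ c])
    with EZ show False by (simp add: expect_const)
  qed
  then obtain c where c: "c \<in> books" "0 < weight c" "Z c \<le> 2" by auto
  have *: "H c \<le> 2 * expect H" if H: "\<And>c. c \<in> books \<Longrightarrow> 0 \<le> H c" and "0 \<le> expect H" "H c / expect H \<le> 2"
    for H :: "(nat \<Rightarrow> 'x) \<Rightarrow> real"
  proof (cases "expect H = 0")
    case True
    then have "\<forall>c\<in>books. weight c * H c = 0"
      unfolding expect_def using finite_books weight_nonneg H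
      by (subst (asm) sum_nonneg_eq_0_iff) auto
    then show ?thesis using c True by auto
  qed (use that in \<open>auto simp: field_simps\<close>)
  have "0 \<le> F c / expect F" "0 \<le> G c / expect G" using F0 G0 F G c by auto
  with c have "F c / expect F \<le> 2" "G c / expect G \<le> 2" unfolding Z_def by linarith+
  then show thesis using that c F0 G0 F G * by blast
qed

text \<open>Gallager's bound. Replacing \<open>u powr s\<close> by its tangent at the mean makes the estimate
  linear in the competing codewords, so that pairwise independence suffices.\<close>

lemma expect_ml_error_le:
  fixes V :: "'x \<Rightarrow> real"
  assumes V: "\<And>x. x \<in> A \<Longrightarrow> 0 \<le> V x" and s: "0 \<le> s" "s \<le> 1" and k: "k < N"
  shows "expect (\<lambda>c. V (c k) * of_bool (\<exists>l<N. l \<noteq> k \<and> V (c k) \<le> V (c l)))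
    \<le> real N powr s * mean (\<lambda>x. V x powr (1 / (1 + s))) powr (1 + s)"
proof -
  define b where "b = 1 / (1 + s)"
  define f where "f x = V x powr b" for x
  define m where "m = mean f"
  have b: "0 < b" "b + b * s = 1" using s by (auto simp: b_def field_simps)
  have m0: "0 \<le> m" unfolding m_def by (rule mean_nonneg) (auto simp: f_def)
  \<comment> \<open>The competitors' values of \<open>f\<close> sum to \<open>(N - 1) * m\<close> in
    mean; \<open>N * m\<close> is the simpler point of tangency and stays positive for a single
    codeword. If \<open>m = 0\<close>, any positive point works, since the final bound is then
    0.\<close>
  define v where "v = (if m = 0 then 1 else real N * m)"
  have v: "0 < v" using m0 k by (auto simp: v_def)
  have pw: "V (c k) * of_bool (\<exists>l<N. l \<noteq> k \<and> V (c k) \<le> V (c l))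
      \<le> s * v powr (s - 1) * (\<Sum>l\<in>{..<N} - {k}. f (c k) * f (c l)) + (1 - s) * v powr s * f (c k)"
    (is "?l \<le> ?r") if c: "c \<in> books" for c
  proof (cases "V (c k) = 0 \<or> \<not>(\<exists>l<N. l \<noteq> k \<and> V (c k) \<le> V (c l))")
    case True
    have "0 \<le> ?r" using s by (auto intro!: add_nonneg_nonneg mult_nonneg_nonneg sum_nonneg simp: f_def)
    with True show ?thesis by auto
  next
    case False
    then obtain l where l: "l < N" "l \<noteq> k" "V (c k) \<le> V (c l)" by auto
    have Vk: "0 < V (c k)" using False V[OF books_mem[OF c k]] by auto
    define S where "S = (\<Sum>l\<in>{..<N} - {k}. f (c l))"
    have "f (c k) \<le> f (c l)" unfolding f_def using b l Vk by (intro powr_mono2) auto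
    also have "\<dots> \<le> S" unfolding S_def using l
      by (intro member_le_sum) (auto simp: f_def)
    finally have S: "f (c k) \<le> S" .
    \<comment> \<open>As \<open>b + b * s = 1\<close>, the likelihood splits into
      \<open>f (c k)\<close> and its power \<open>s\<close>. Only the latter is estimated by
      \<open>S\<close>, which dominates \<open>f (c k)\<close> because some competitor is at least
      as likely.\<close>
    have "?l = V (c k) powr b * (V (c k) powr b) powr s"
      using False Vk b by (simp add: powr_powr flip: powr_add)
    also have "\<dots> \<le> f (c k) * S powr s"
      unfolding f_def[symmetric] using S s by (intro mult_left_mono powr_mono2) (auto simp: f_def)
    also have "\<dots> \<le> f (c k) * (s * S * v powr (s - 1) + (1 - s) * v powr s)"
      using s v S by (intro mult_left_mono powr_le_tangent) (auto simp: f_def intro: order_trans[rotated])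
    also have "\<dots> = ?r"
      unfolding S_def by (simp add: sum_distrib_left algebra_simps)
    finally show ?thesis .
  qed
  have "expect (\<lambda>c. V (c k) * of_bool (\<exists>l<N. l \<noteq> k \<and> V (c k) \<le> V (c l)))
     \<le> s * v powr (s - 1) * (\<Sum>l\<in>{..<N} - {k}. expect (\<lambda>c. f (c k) * f (c l)))
        + (1 - s) * v powr s * expect (\<lambda>c. f (c k))"
    using expect_mono[OF pw] by (simp add: expect_add expect_cmult expect_sum)
  also have "\<dots> = s * v powr (s - 1) * (real (N - 1) * (m * m)) + (1 - s) * v powr s * m"
    using k by (simp add: expect_two expect_one m_def)
  also have "\<dots> \<le> s * v powr (s - 1) * (real N * (m * m)) + (1 - s) * v powr s * m"
    using s by (intro add_mono mult_left_mono mult_right_mono) auto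
  also have "\<dots> = real N powr s * m powr (1 + s)"
  proof (cases "m = 0")
    case False
    then have "s * v powr (s - 1) * (real N * (m * m)) = s * (v * v powr (s - 1)) * m"
      by (simp add: v_def)
    also have "\<dots> = s * v powr s * m"
      using v by (simp add: powr_mult_base)
    finally have "s * v powr (s - 1) * (real N * (m * m)) + (1 - s) * v powr s * m = v powr s * m"
      by (simp add: algebra_simps)
    then show ?thesis using False m0 by (simp add: v_def powr_mult powr_add)
  qed auto
  finally show ?thesis by (simp add: m_def f_def[abs_def] b_def)
qed

section \<open>Deviation of block averages from their mean\<close>

text \<open>Cross terms of the centred variables vanish by pairwise independence, and the variance
  is at most the second moment.\<close>

lemma expect_empirical_variance_le:
  assumes J: "J \<subseteq> {..<N}" and L: "card J = L" "0 < L"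
  shows "expect (\<lambda>c. ((\<Sum>k\<in>J. b (c k)) / L - mean b)\<^sup>2) \<le> mean (\<lambda>x. (b x)\<^sup>2) / L"
proof -
  define g where "g x = b x - mean b" for x
  have mg: "mean g = 0"
    using mean_add[of b "\<lambda>_. - mean b"] by (simp add: g_def[abs_def] mean_const)
  have fJ: "finite J" using J finite_subset by blast
  have eq: "((\<Sum>k\<in>J. b (c k)) / L - mean b)\<^sup>2 = 1 / (real L)\<^sup>2 * (\<Sum>k\<in>J. \<Sum>l\<in>J. g (c k) * g (c l))" for c
  proof -
    have "(\<Sum>k\<in>J. b (c k)) / L - mean b = (\<Sum>k\<in>J. g (c k)) / L"
      using L by (simp add: g_def sum_subtractf field_simps)
    then show ?thesis by (simp add: power_divide power2_eq_square sum_product)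
  qed
  have var: "mean (\<lambda>x. (g x)\<^sup>2) \<le> mean (\<lambda>x. (b x)\<^sup>2)"
  proof -
    have "mean (\<lambda>x. (g x)\<^sup>2) = mean (\<lambda>x. (b x)\<^sup>2 + (- (2 * mean b) * b x + (mean b)\<^sup>2))"
      by (simp add: g_def power2_eq_square algebra_simps)
    also have "\<dots> = mean (\<lambda>x. (b x)\<^sup>2) - (mean b)\<^sup>2"
      by (simp only: mean_add mean_cmult mean_const) (simp add: power2_eq_square)
    finally show ?thesis by simp
  qed
  have E: "expect (\<lambda>c. g (c k) * g (c l)) = (if k = l then mean (\<lambda>x. (g x)\<^sup>2) else 0)"
    if "k \<in> J" "l \<in> J" for k l
    using expect_two[of k l g g] expect_one[of k "\<lambda>x. (g x)\<^sup>2"] that J mg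
    by (auto simp: power2_eq_square)
  have "expect (\<lambda>c. ((\<Sum>k\<in>J. b (c k)) / L - mean b)\<^sup>2)
      = 1 / (real L)\<^sup>2 * (\<Sum>k\<in>J. \<Sum>l\<in>J. expect (\<lambda>c. g (c k) * g (c l)))"
    by (simp only: eq expect_cmult expect_sum)
  also have "\<dots> = mean (\<lambda>x. (g x)\<^sup>2) / L"
    using fJ L by (simp add: E power2_eq_square)
  also have "\<dots> \<le> mean (\<lambda>x. (b x)\<^sup>2) / L"
    using var by (simp add: divide_right_mono)
  finally show ?thesis .
qed

text \<open>A von Bahr--Esseen type bound: the part of \<open>B\<close> above the level \<open>T\<close> is estimated in
  the first moment and the part below it in the second; the level balances the two.\<close>

lemma expect_empirical_deviation_le:
  fixes B :: "'x \<Rightarrow> real"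
  assumes B: "\<And>x. x \<in> A \<Longrightarrow> 0 \<le> B x" and t: "- 1/2 \<le> t" "t \<le> 0"
    and J: "J \<subseteq> {..<N}" and L: "card J = L" "0 < L"
  shows "expect (\<lambda>c. \<bar>(\<Sum>k\<in>J. B (c k)) / L - mean B\<bar>)
    \<le> 3 * (real L powr t * mean (\<lambda>x. B x powr (1 / (1 + t))) powr (1 + t))"
proof -
  define a where "a = 1 / (1 + t)"
  define m where "m = mean (\<lambda>x. B x powr a)"
  define \<tau> where "\<tau> = real L powr t * m powr (1 + t)"
  \<comment> \<open>The range of \<open>t\<close> is what places \<open>a\<close> between 1 and 2:
    moment \<open>a\<close> then controls the first moment above a level and the second moment below
    it.\<close>
  have a: "1 \<le> a" "a \<le> 2" "(1 + t) * a = 1" using t by (auto simp: a_def field_simps)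
  have m0: "0 \<le> m" unfolding m_def by (rule mean_nonneg) auto
  have first: "expect (\<lambda>c. \<bar>(\<Sum>k\<in>J. h (c k)) / L - mean h\<bar>) \<le> 2 * mean h"
    if h: "\<And>x. x \<in> A \<Longrightarrow> 0 \<le> h x" for h :: "'x \<Rightarrow> real"
  proof -
    have "expect (\<lambda>c. \<bar>(\<Sum>k\<in>J. h (c k)) / L - mean h\<bar>) \<le> expect (\<lambda>c. 1 / L * (\<Sum>k\<in>J. h (c k)) + mean h)"
    proof (rule expect_mono)
      fix c assume "c \<in> books"
      then have "0 \<le> (\<Sum>k\<in>J. h (c k)) / L"
        using J by (intro divide_nonneg_nonneg sum_nonneg h books_mem) auto
      then show "\<bar>(\<Sum>k\<in>J. h (c k)) / L - mean h\<bar> \<le> 1 / L * (\<Sum>k\<in>J. h (c k)) + mean h"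
        using mean_nonneg[of h] h by simp
    qed
    also have "\<dots> = 1 / L * (\<Sum>k\<in>J. expect (\<lambda>c. h (c k))) + mean h"
      by (simp only: expect_add expect_cmult expect_sum expect_const)
    also have "(\<Sum>k\<in>J. expect (\<lambda>c. h (c k))) = (\<Sum>k\<in>J. mean h)"
      using J by (intro sum.cong expect_one) auto
    finally show ?thesis using L by simp
  qed
  show ?thesis
  proof (cases "m = 0")
    case True
    have "\<forall>x\<in>A. P x * B x powr a = 0"
      using True unfolding m_def mean_def using finite_A P_nonneg
      by (subst (asm) sum_nonneg_eq_0_iff) auto
    then have "mean B = 0" unfolding mean_def by (intro sum.neutral) auto
    moreover have "mean (\<lambda>x. B x powr (1 / (1 + t))) = 0" using True by (simp add: m_def a_def)
    ultimately show ?thesis using first[of B] B by simp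
  next
    case False
    with m0 have m: "0 < m" by simp
    \<comment> \<open>This level gives the upper part mean at most \<open>\<tau>\<close> and the
      lower part second moment at most \<open>L * \<tau>\<^sup>2\<close>, hence an average with
      variance at most \<open>\<tau>\<^sup>2\<close>.\<close>
    define T where "T = (L * m) powr (1 + t)"
    have T: "0 < T" using m L by (simp add: T_def)
    have \<tau>: "0 < \<tau>" using m L by (simp add: \<tau>_def)
    define lo where "lo x = (if B x \<le> T then B x else 0)" for x
    define hi where "hi x = (if B x \<le> T then 0 else B x)" for x
    have Bsplit: "B x = lo x + hi x" for x by (auto simp: lo_def hi_def)
    have "mean hi \<le> mean (\<lambda>x. T powr (1 - a) * B x powr a)"
    proof (rule mean_mono)
      fix x assume "x \<in> A"
      show "hi x \<le> T powr (1 - a) * B x powr a"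
      proof (cases "B x \<le> T")
        case False
        then have "B x = B x powr (1 - a) * B x powr a"
          using T by (simp flip: powr_add)
        also have "\<dots> \<le> T powr (1 - a) * B x powr a"
          using False T a by (intro mult_right_mono powr_mono2') auto
        finally show ?thesis by (simp add: hi_def False)
      qed (auto simp: hi_def)
    qed
    also have "\<dots> = T powr (1 - a) * m" by (simp add: mean_cmult m_def)
    also have "T powr (1 - a) = (L * m) powr t"
    proof -
      have "(1 + t) * (1 - a) = t" using a(3) by (simp add: algebra_simps)
      then show ?thesis by (simp add: T_def powr_powr)
    qed
    also have "(L * m) powr t * m = \<tau>"
      using m by (simp add: \<tau>_def powr_mult powr_add)
    finally have hi: "mean hi \<le> \<tau>" .
    have "mean (\<lambda>x. (lo x)\<^sup>2) \<le> mean (\<lambda>x. T powr (2 - a) * B x powr a)"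
    proof (rule mean_mono)
      fix x assume x: "x \<in> A"
      show "(lo x)\<^sup>2 \<le> T powr (2 - a) * B x powr a"
      proof (cases "0 < B x \<and> B x \<le> T")
        case True
        then have "(B x)\<^sup>2 = B x powr (2 - a) * B x powr a"
          by (simp flip: powr_add)
        also have "\<dots> \<le> T powr (2 - a) * B x powr a"
          using True T a by (intro mult_right_mono powr_mono2) auto
        finally show ?thesis by (simp add: lo_def True)
      qed (use B[OF x] in \<open>auto simp: lo_def\<close>)
    qed
    also have "\<dots> = T powr (2 - a) * m" by (simp add: mean_cmult m_def)
    also have "T powr (2 - a) = (L * m) powr (1 + 2 * t)"
    proof -
      have "(1 + t) * (2 - a) = 1 + 2 * t" using a(3) by (simp add: algebra_simps)
      then show ?thesis by (simp add: T_def powr_powr)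
    qed
    also have "(L * m) powr (1 + 2 * t) * m = L * \<tau>\<^sup>2"
    proof -
      have "1 + 2 * t = 1 + (t + t)" by simp
      then show ?thesis
        using m L by (simp only: \<tau>_def powr_mult powr_add) (simp add: power2_eq_square)
    qed
    finally have lo: "mean (\<lambda>x. (lo x)\<^sup>2) \<le> L * \<tau>\<^sup>2" .
    define Z where "Z c = (\<Sum>k\<in>J. lo (c k)) / L - mean lo" for c
    have Z2: "expect (\<lambda>c. (Z c)\<^sup>2) \<le> \<tau>\<^sup>2"
      using expect_empirical_variance_le[OF J L, of lo] lo L
      unfolding Z_def by (elim order_trans) (simp add: field_simps)
    \<comment> \<open>The inequality between arithmetic and geometric means, scaled by
      \<open>\<tau>\<close>, replaces Cauchy-Schwarz.\<close>
    have "expect (\<lambda>c. \<bar>Z c\<bar>) \<le> expect (\<lambda>c. 1 / (2 * \<tau>) * (Z c)\<^sup>2 + \<tau> / 2)"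
    proof (rule expect_mono)
      fix c
      have "0 \<le> (\<bar>Z c\<bar> - \<tau>)\<^sup>2" by simp
      then show "\<bar>Z c\<bar> \<le> 1 / (2 * \<tau>) * (Z c)\<^sup>2 + \<tau> / 2"
        using \<tau> by (simp add: power2_diff field_simps power2_eq_square)
    qed
    also have "\<dots> = 1 / (2 * \<tau>) * expect (\<lambda>c. (Z c)\<^sup>2) + \<tau> / 2"
      by (simp only: expect_add expect_cmult expect_const)
    also have "\<dots> \<le> 1 / (2 * \<tau>) * \<tau>\<^sup>2 + \<tau> / 2"
      using \<tau> Z2 by (intro add_right_mono mult_left_mono) auto
    also have "\<dots> = \<tau>" using \<tau> by (simp add: power2_eq_square)
    finally have Z\<tau>: "expect (\<lambda>c. \<bar>Z c\<bar>) \<le> \<tau>" .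
    have "expect (\<lambda>c. \<bar>(\<Sum>k\<in>J. B (c k)) / L - mean B\<bar>)
      \<le> expect (\<lambda>c. \<bar>Z c\<bar> + \<bar>(\<Sum>k\<in>J. hi (c k)) / L - mean hi\<bar>)"
      unfolding Bsplit Z_def
      by (intro expect_mono) (simp add: mean_add sum.distrib add_divide_distrib)
    \<comment> \<open>The constant 3 of the statement: one \<open>\<tau>\<close> from the lower part
      and two from the triangle inequality for the upper part.\<close>
    also have "\<dots> \<le> \<tau> + 2 * mean hi"
      unfolding expect_add using Z\<tau> B by (intro add_mono first) (auto simp: hi_def)
    also have "\<dots> \<le> 3 * \<tau>" using hi by simp
    finally show ?thesis by (simp add: \<tau>_def m_def a_def)
  qed
qed

end

section \<open>Words and the memoryless extension\<close>

lemma finite_words [simp]: "finite (words n :: 'a::finite list set)"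
  using finite_lists_length_eq[of "UNIV :: 'a set" n] by (simp add: words_def)

text \<open>The factors may vary with the position because they will contain the letters of a fixed
  output word; the induction also shifts them.\<close>

lemma sum_words_prod:
  fixes f :: "nat \<Rightarrow> 'a::finite \<Rightarrow> real"
  shows "(\<Sum>xs\<in>words n. \<Prod>i<n. f i (xs ! i)) = (\<Prod>i<n. \<Sum>x\<in>UNIV. f i x)"
proof (induction n arbitrary: f)
  case 0
  have "words 0 = {[] :: 'a list}" by (auto simp: words_def)
  then show ?case by simp
next
  case (Suc n)
  have w: "words (Suc n) = (\<lambda>(x, xs). x # xs) ` (UNIV \<times> (words n :: 'a list set))"
    by (auto simp: words_def image_iff length_Suc_conv)
  have "(\<Sum>xs\<in>words (Suc n). \<Prod>i<Suc n. f i (xs ! i))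
      = (\<Sum>(x, xs)\<in>UNIV \<times> words n. f 0 x * (\<Prod>i<n. f (Suc i) (xs ! i)))"
    unfolding w by (subst sum.reindex)
      (auto simp: inj_on_def prod.lessThan_Suc_shift case_prod_unfold simp del: prod.lessThan_Suc)
  also have "\<dots> = (\<Sum>x\<in>UNIV. f 0 x) * (\<Sum>xs\<in>words n. \<Prod>i<n. f (Suc i) (xs ! i))"
    by (simp add: sum_product sum.cartesian_product)
  also have "\<dots> = (\<Prod>i<Suc n. \<Sum>x\<in>UNIV. f i x)"
    by (simp add: Suc[of "\<lambda>i. f (Suc i)"] prod.lessThan_Suc_shift del: prod.lessThan_Suc)
  finally show ?case .
qed

definition word_prob :: "('a \<Rightarrow> real) \<Rightarrow> nat \<Rightarrow> 'a list \<Rightarrow> real" where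
  "word_prob p n xs = (\<Prod>i<n. p (xs ! i))"

lemma codebook_words:
  fixes p :: "'a::finite \<Rightarrow> real"
  assumes "distr p"
  shows "codebook (words n) (word_prob p n)"
proof
  show "finite (words n :: 'a list set)" by simp
  show "0 \<le> word_prob p n xs" for xs
    using assms by (auto simp: word_prob_def distr_def intro!: prod_nonneg)
  show "(\<Sum>xs\<in>words n. word_prob p n xs) = 1"
    using assms by (simp add: word_prob_def sum_words_prod[of "\<lambda>_. p"] distr_def)
qed

lemma chan_ext_nonneg: "channel W \<Longrightarrow> 0 \<le> chan_ext W n xs ys"
  by (auto simp: chan_ext_def channel_def intro!: prod_nonneg)

text \<open>Some input has positive probability and some output is reachable from it. This lets
  \<open>exp\<close> undo the \<open>ln\<close> in \<open>phi_fn\<close>.\<close>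

lemma phi_fn_arg_pos:
  assumes "channel W" "distr p"
  shows "0 < (\<Sum>y\<in>UNIV. (\<Sum>x\<in>UNIV. p x * W x y powr (1 / (1 + t))) powr (1 + t))"
proof -
  from assms obtain x where x: "0 < p x"
    unfolding distr_def by (metis less_eq_real_def sum.neutral zero_neq_one)
  from assms obtain y where y: "0 < W x y"
    unfolding channel_def by (metis less_eq_real_def sum.neutral zero_neq_one)
  have "0 < (\<Sum>x\<in>UNIV. p x * W x y powr (1 / (1 + t)))"
    using assms x y by (intro sum_pos2[of _ x]) (auto simp: distr_def)
  then show ?thesis
    by (intro sum_pos2[of _ y]) auto
qed

text \<open>The reliability bound (with nonnegative parameter) and the secrecy bound (with
  nonpositive parameter) both end in this sum. Each mean is a product over positions, so the whole
  is the power \<open>n\<close> of a single-letter sum.\<close>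

lemma sum_words_mean_powr:
  assumes W: "channel W" and p: "distr p"
  shows "(\<Sum>ys\<in>words n. codebook.mean (words n) (word_prob p n)
            (\<lambda>xs. chan_ext W n xs ys powr (1 / (1 + t))) powr (1 + t))
         = exp (n * phi_fn t W p)"
proof -
  have W0: "0 \<le> W x y" for x y using W by (auto simp: channel_def)
  have p0: "0 \<le> p x" for x using p by (auto simp: distr_def)
  define f where "f y = (\<Sum>x\<in>UNIV. p x * W x y powr (1 / (1 + t)))" for y
  have f0: "0 \<le> f y" for y unfolding f_def using p0 by (intro sum_nonneg) auto
  have mean: "codebook.mean (words n) (word_prob p n) (\<lambda>xs. chan_ext W n xs ys powr (1 / (1 + t)))
      = (\<Prod>i<n. f (ys ! i))" if "ys \<in> words n" for ys
  proof -
    have "codebook.mean (words n) (word_prob p n) (\<lambda>xs. chan_ext W n xs ys powr (1 / (1 + t)))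
        = (\<Sum>xs\<in>words n. \<Prod>i<n. p (xs ! i) * W (xs ! i) (ys ! i) powr (1 / (1 + t)))"
      unfolding codebook.mean_def[OF codebook_words[OF p]] using that
      by (intro sum.cong) (auto simp: words_def word_prob_def chan_ext_def prod_powr_distrib W0 prod.distrib)
    also have "\<dots> = (\<Prod>i<n. f (ys ! i))"
      unfolding f_def by (rule sum_words_prod)
    finally show ?thesis .
  qed
  have "(\<Sum>ys\<in>words n. codebook.mean (words n) (word_prob p n)
            (\<lambda>xs. chan_ext W n xs ys powr (1 / (1 + t))) powr (1 + t))
      = (\<Sum>ys\<in>words n. \<Prod>i<n. f (ys ! i) powr (1 + t))"
    by (intro sum.cong) (auto simp: mean prod_powr_distrib f0)
  also have "\<dots> = (\<Sum>y\<in>UNIV. f y powr (1 + t)) ^ n"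
    by (simp add: sum_words_prod[of "\<lambda>_ y. f y powr (1 + t)"])
  also have "\<dots> = exp (n * phi_fn t W p)"
    using phi_fn_arg_pos[OF W p] by (simp add: phi_fn_def f_def exp_of_nat_mult)
  finally show ?thesis .
qed

section \<open>Leakage criteria\<close>

lemma out_ext_nonneg:
  assumes "channel W" "is_wtcode n \<Phi>" "i < wc_M \<Phi>"
  shows "0 \<le> out_ext W n (wc_Q \<Phi> i) zs"
  unfolding out_ext_def using assms
  by (intro sum_nonneg mult_nonneg_nonneg chan_ext_nonneg) (auto simp: is_wtcode_def)

lemma d_E_nonneg: "1 \<le> wc_M \<Phi> \<Longrightarrow> 0 \<le> d_E W n \<Phi>"
  unfolding d_E_def by (intro mult_nonneg_nonneg sum_nonneg) auto

lemma eps_B_nonneg: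
  assumes "channel W" "is_wtcode n \<Phi>"
  shows "0 \<le> eps_B W n \<Phi>"
  unfolding eps_B_def using assms
  by (intro mult_nonneg_nonneg sum_nonneg out_ext_nonneg) auto

text \<open>Triangle inequality through an arbitrary reference \<open>q\<close>: each index occurs
  in \<open>2 * (M - 1)\<close> ordered pairs.\<close>

lemma d_E_le:
  assumes "1 \<le> wc_M \<Phi>"
  shows "d_E W n \<Phi> \<le> 2 * ((\<Sum>i<wc_M \<Phi>. \<Sum>zs\<in>words n. \<bar>out_ext W n (wc_Q \<Phi> i) zs - q zs\<bar>) / wc_M \<Phi>)"
proof (cases "wc_M \<Phi> = 1")
  case True
  \<comment> \<open>With one message the inner sum is empty, and the prefactor \<open>1 / 0\<close>
    is 0.\<close>
  then have "d_E W n \<Phi> = 0" by (simp add: d_E_def)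
  then show ?thesis by (simp add: sum_nonneg)
next
  case False
  define M where "M = wc_M \<Phi>"
  have M: "2 \<le> M" using assms False by (simp add: M_def)
  define a where "a i = out_ext W n (wc_Q \<Phi> i)" for i
  define D where "D i = (\<Sum>zs\<in>words n. \<bar>a i zs - q zs\<bar>)" for i
  have "(\<Sum>i<M. \<Sum>j\<in>{..<M} - {i}. \<Sum>zs\<in>words n. \<bar>a i zs - a j zs\<bar>)
      \<le> (\<Sum>i<M. \<Sum>j\<in>{..<M} - {i}. D i + D j)"
    unfolding D_def sum.distrib[symmetric] by (intro sum_mono) (auto simp: abs_le_iff)
  also have "\<dots> = (\<Sum>i<M. (real M - 2) * D i + (\<Sum>j<M. D j))"
  proof (rule sum.cong)
    fix i assume i: "i \<in> {..<M}"
    then have "(\<Sum>j\<in>{..<M} - {i}. D i + D j) = (\<Sum>j<M. D i + D j) - 2 * D i"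
      by (simp add: sum_diff1)
    then show "(\<Sum>j\<in>{..<M} - {i}. D i + D j) = (real M - 2) * D i + (\<Sum>j<M. D j)"
      by (simp add: sum.distrib algebra_simps)
  qed auto
  also have "\<dots> = 2 * (real M - 1) * (\<Sum>i<M. D i)"
    unfolding sum.distrib sum_distrib_left[symmetric] by (simp add: algebra_simps)
  finally have "d_E W n \<Phi> \<le> 1 / (real M * (real M - 1)) * (2 * (real M - 1) * (\<Sum>i<M. D i))"
    unfolding d_E_def M_def[symmetric] a_def[symmetric] using M by (intro mult_left_mono) auto
  also have "\<dots> = 2 * ((\<Sum>i<M. D i) / M)" using M by (simp add: field_simps)
  finally show ?thesis by (simp add: D_def a_def M_def)
qed

text \<open>Termwise Gibbs inequality, from \<open>ln x \<le> x - 1\<close>. The third hypothesis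
  excludes \<open>a > 0 = b\<close>, where the conventional value of the right-hand side is
  0.\<close>

lemma mult_ln_divide_ge:
  fixes a b :: real
  assumes "0 \<le> a" "0 \<le> b" "b = 0 \<Longrightarrow> a = 0"
  shows "a - b \<le> a * ln (a / b)"
proof (cases "a = 0")
  case False
  then have ab: "0 < a" "0 < b" using assms by (auto simp: less_le)
  then have "ln (b / a) \<le> b / a - 1" by (intro ln_le_minus_one) auto
  then have "a * ln (b / a) \<le> a * (b / a - 1)" using ab by (intro mult_left_mono) auto
  moreover have "a * (b / a - 1) = b - a" using ab by (simp add: field_simps)
  ultimately show ?thesis using ab by (simp add: ln_div right_diff_distrib)
qed (use assms in auto)

text \<open>The left-hand side is nonpositive when \<open>a \<le> b\<close>. Otherwise write
  \<open>a = (a - b) + b\<close>: the first summand meets a logarithm of at most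
  \<open>ln M\<close>, the second contributes at most \<open>a - b\<close>.\<close>

lemma mult_ln_divide_le:
  fixes a b M :: real
  assumes "0 \<le> a" "0 \<le> b" "a \<le> M * b" "1 \<le> M"
  shows "a * ln (a / b) \<le> (1 + ln M) * \<bar>a - b\<bar>"
proof (cases "a \<le> b")
  case True
  have "ln (a / b) \<le> 0 \<or> a = 0" using True assms by (cases "a = 0") auto
  then have "a * ln (a / b) \<le> 0" using assms by (auto simp: mult_nonneg_nonpos)
  also have "0 \<le> (1 + ln M) * \<bar>a - b\<bar>" using assms by simp
  finally show ?thesis .
next
  case False
  have b: "0 < b" using False assms by (cases "b = 0") auto
  have "ln (a / b) \<le> ln M"
    using False b assms by (intro ln_mono) (auto simp: field_simps)
  then have "(a - b) * ln (a / b) \<le> (a - b) * ln M" using False by (intro mult_left_mono) auto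
  moreover have "b * ln (a / b) \<le> b * (a / b - 1)"
    using b False by (intro mult_left_mono ln_le_minus_one) auto
  ultimately show ?thesis using False b by (simp add: algebra_simps)
qed

text \<open>The average dominates each output up to the factor \<open>M\<close>, so the termwise
  bounds apply; the L1 distance of an output to the average is at most the average of its distances
  to all outputs.\<close>

lemma
  assumes W: "channel W" and \<Phi>: "is_wtcode n \<Phi>"
  shows I_E_nonneg: "0 \<le> I_E W n \<Phi>"
    and I_E_le: "I_E W n \<Phi> \<le> (1 + ln (wc_M \<Phi>)) * d_E W n \<Phi>"
proof -
  define M where "M = wc_M \<Phi>"
  define a where "a i = out_ext W n (wc_Q \<Phi> i)" for i
  define b where "b = avg_out W n \<Phi>"
  have M: "1 \<le> M" using \<Phi> by (simp add: is_wtcode_def M_def)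
  have a0: "0 \<le> a i zs" if "i < M" for i zs
    using out_ext_nonneg[OF W \<Phi>] that by (simp add: a_def M_def)
  have b: "b zs = (\<Sum>i<M. a i zs) / M" for zs
    by (simp add: b_def avg_out_def a_def M_def)
  have b0: "0 \<le> b zs" for zs unfolding b using a0 by (intro divide_nonneg_nonneg sum_nonneg) auto
  have ab: "a i zs \<le> M * b zs" if "i < M" for i zs
  proof -
    have "a i zs \<le> (\<Sum>i<M. a i zs)" using a0 that by (intro member_le_sum) auto
    then show ?thesis using M by (simp add: b)
  qed
  have I: "I_E W n \<Phi> = (\<Sum>i<M. \<Sum>zs\<in>words n. a i zs * ln (a i zs / b zs)) / M"
    by (simp add: I_E_def KL_def M_def a_def b_def sum_divide_distrib)
  \<comment> \<open>The lower bounds of the Gibbs terms cancel in total, which yields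
    nonnegativity.\<close>
  have "(\<Sum>i<M. \<Sum>zs\<in>words n. a i zs - b zs) = (\<Sum>zs\<in>words n. \<Sum>i<M. a i zs - b zs)"
    by (rule sum.swap)
  also have "\<dots> = 0" using M by (simp add: sum_subtractf b)
  finally have "0 = (\<Sum>i<M. \<Sum>zs\<in>words n. a i zs - b zs)" ..
  also have "\<dots> \<le> (\<Sum>i<M. \<Sum>zs\<in>words n. a i zs * ln (a i zs / b zs))"
  proof (intro sum_mono mult_ln_divide_ge)
    fix i zs assume "i \<in> {..<M}" "b zs = 0"
    then show "a i zs = 0" using a0[of i zs] ab[of i zs] by simp
  qed (use a0 b0 in auto)
  finally show "0 \<le> I_E W n \<Phi>" unfolding I by simp
  define S where "S = (\<Sum>i<M. \<Sum>j\<in>{..<M} - {i}. \<Sum>zs\<in>words n. \<bar>a i zs - a j zs\<bar>)"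
  have S0: "0 \<le> S" unfolding S_def by (intro sum_nonneg) auto
  have dev: "(\<Sum>zs\<in>words n. \<bar>a i zs - b zs\<bar>)
      \<le> (\<Sum>j\<in>{..<M} - {i}. \<Sum>zs\<in>words n. \<bar>a i zs - a j zs\<bar>) / M" if i: "i < M" for i
  proof -
    have "\<bar>a i zs - b zs\<bar> \<le> (\<Sum>j<M. \<bar>a i zs - a j zs\<bar>) / M" for zs
    proof -
      have "a i zs - b zs = (\<Sum>j<M. a i zs - a j zs) / M"
        using M by (simp add: b sum_subtractf field_simps)
      then show ?thesis using M by (simp add: divide_right_mono)
    qed
    then have "(\<Sum>zs\<in>words n. \<bar>a i zs - b zs\<bar>) \<le> (\<Sum>zs\<in>words n. (\<Sum>j<M. \<bar>a i zs - a j zs\<bar>) / M)"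
      by (rule sum_mono)
    also have "\<dots> = (\<Sum>j<M. \<Sum>zs\<in>words n. \<bar>a i zs - a j zs\<bar>) / M"
      by (subst sum.swap) (simp add: sum_divide_distrib)
    also have "(\<Sum>j<M. \<Sum>zs\<in>words n. \<bar>a i zs - a j zs\<bar>)
        = (\<Sum>j\<in>{..<M} - {i}. \<Sum>zs\<in>words n. \<bar>a i zs - a j zs\<bar>)"
      by (rule sum.mono_neutral_right) auto
    finally show ?thesis .
  qed
  have "(\<Sum>i<M. \<Sum>zs\<in>words n. a i zs * ln (a i zs / b zs))
      \<le> (\<Sum>i<M. \<Sum>zs\<in>words n. (1 + ln M) * \<bar>a i zs - b zs\<bar>)"
    using a0 b0 ab M by (intro sum_mono mult_ln_divide_le) auto
  also have "\<dots> = (1 + ln M) * (\<Sum>i<M. \<Sum>zs\<in>words n. \<bar>a i zs - b zs\<bar>)"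
    by (simp add: sum_distrib_left)
  also have "\<dots> \<le> (1 + ln M) * (S / M)"
    unfolding S_def sum_divide_distrib[of _ "{..<M}"]
    using dev M by (intro mult_left_mono sum_mono) auto
  finally have "I_E W n \<Phi> \<le> (1 + ln M) * (S / M) / M"
    unfolding I by (intro divide_right_mono) auto
  also have "\<dots> = (1 + ln M) * (S / (real M * M))" by simp
  also have "\<dots> \<le> (1 + ln M) * d_E W n \<Phi>"
  proof (intro mult_left_mono)
    have d: "d_E W n \<Phi> = S / (real M * (real M - 1))"
      by (simp add: d_E_def S_def M_def a_def)
    show "S / (real M * M) \<le> d_E W n \<Phi>"
    proof (cases "M = 1")
      case True
      then have "S = 0" by (simp add: S_def)
      then show ?thesis by (simp add: d)
    next
      case False
      then show ?thesis unfolding d using S0 M by (intro divide_left_mono) auto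
    qed
    show "0 \<le> 1 + ln (real M)" using M by simp
  qed
  finally show "I_E W n \<Phi> \<le> (1 + ln (wc_M \<Phi>)) * d_E W n \<Phi>" by (simp add: M_def)
qed

section \<open>The code of a codebook\<close>

text \<open>The decoder estimates the codeword index, not just the message. Ties may be broken
  arbitrarily, since the error event of Gallager's bound includes them.\<close>

definition ml_decode :: "('a \<Rightarrow> 'b \<Rightarrow> real) \<Rightarrow> nat \<Rightarrow> nat \<Rightarrow> (nat \<Rightarrow> 'a list) \<Rightarrow> 'b list \<Rightarrow> nat" where
  "ml_decode W n N c ys =
     (SOME k. k < N \<and> (\<forall>l<N. chan_ext W n (c l) ys \<le> chan_ext W n (c k) ys))"

lemma ml_decode:
  assumes "0 < N"
  shows "ml_decode W n N c ys < N"
    and "l < N \<Longrightarrow> chan_ext W n (c l) ys \<le> chan_ext W n (c (ml_decode W n N c ys)) ys"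
proof -
  define v where "v k = chan_ext W n (c k) ys" for k
  have fin: "finite (v ` {..<N})" "v ` {..<N} \<noteq> {}" using assms by auto
  from Max_in[OF fin] obtain k where k: "k < N" "v k = Max (v ` {..<N})" by auto
  have "k < N \<and> (\<forall>l<N. v l \<le> v k)" using k fin by auto
  then have "\<exists>k. k < N \<and> (\<forall>l<N. chan_ext W n (c l) ys \<le> chan_ext W n (c k) ys)"
    unfolding v_def by blast
  from someI_ex[OF this]
  show "ml_decode W n N c ys < N"
    and "l < N \<Longrightarrow> chan_ext W n (c l) ys \<le> chan_ext W n (c (ml_decode W n N c ys)) ys"
    unfolding ml_decode_def by blast+
qed

definition block :: "nat \<Rightarrow> nat \<Rightarrow> nat set" where
  "block L i = {i * L..<i * L + L}"

text \<open>Codewords may coincide, so the input law counts indices with multiplicity; decoding sets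
  stay disjoint because the decoded index has a single quotient by \<open>L\<close>.\<close>

definition book_code ::
    "('a::finite \<Rightarrow> 'b::finite \<Rightarrow> real) \<Rightarrow> nat \<Rightarrow> nat \<Rightarrow> nat \<Rightarrow> (nat \<Rightarrow> 'a list) \<Rightarrow> ('a, 'b) wtcode" where
  "book_code W n M L c =
     \<lparr>wc_M = M,
      wc_Q = (\<lambda>i xs. (\<Sum>k\<in>block L i. of_bool (c k = xs)) / L),
      wc_D = (\<lambda>i. {ys \<in> words n. ml_decode W n (M * L) c ys div L = i})\<rparr>"

lemma wc_M_book_code [simp]: "wc_M (book_code W n M L c) = M"
  by (simp add: book_code_def)

lemma card_block [simp]: "card (block L i) = L"
  by (simp add: block_def)

lemma block_subset: "i < M \<Longrightarrow> block L i \<subseteq> {..<M * L}"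
  using mult_le_mono1[of "Suc i" M L] by (auto simp: block_def)

lemma block_div: "k \<in> block L i \<Longrightarrow> k div L = i"
proof -
  assume "k \<in> block L i"
  then have "i * L \<le> k" "k < Suc i * L" by (auto simp: block_def)
  then show ?thesis by (simp add: div_nat_eqI mult.commute)
qed

lemma sum_blocks: "(\<Sum>i<M. \<Sum>k\<in>block L i. f k) = (\<Sum>k<M * L. f k)"
  unfolding block_def by (rule sum.nat_group)

lemma out_ext_book_code:
  assumes "i < M" "\<And>k. k < M * L \<Longrightarrow> c k \<in> words n"
  shows "out_ext W n (wc_Q (book_code WB n M L c) i) ys
    = (\<Sum>k\<in>block L i. chan_ext W n (c k) ys) / L"
proof -
  have "out_ext W n (wc_Q (book_code WB n M L c) i) ys
      = (\<Sum>xs\<in>words n. \<Sum>k\<in>block L i. of_bool (c k = xs) * chan_ext W n xs ys) / L"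
    by (simp add: out_ext_def book_code_def sum_divide_distrib sum_distrib_right)
  also have "\<dots> = (\<Sum>k\<in>block L i. \<Sum>xs\<in>words n. of_bool (c k = xs) * chan_ext W n xs ys) / L"
    by (subst sum.swap) simp
  also have "\<dots> = (\<Sum>k\<in>block L i. chan_ext W n (c k) ys) / L"
  proof (intro arg_cong[where f = "\<lambda>x. x / real L"] sum.cong refl)
    fix k assume "k \<in> block L i"
    then have k: "c k \<in> words n" using assms block_subset[of i M L] by auto
    have "(\<Sum>xs\<in>words n. of_bool (c k = xs) * chan_ext W n xs ys)
        = (\<Sum>xs\<in>words n. if c k = xs then chan_ext W n xs ys else 0)"
      by (intro sum.cong) auto
    also have "\<dots> = chan_ext W n (c k) ys" using k by simp
    finally show "(\<Sum>xs\<in>words n. of_bool (c k = xs) * chan_ext W n xs ys) = chan_ext W n (c k) ys" .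
  qed
  finally show ?thesis .
qed

lemma is_wtcode_book_code:
  assumes "1 \<le> M" "1 \<le> L" and c: "\<And>k. k < M * L \<Longrightarrow> c k \<in> words n"
  shows "is_wtcode n (book_code W n M L c)"
proof -
  let ?Q = "wc_Q (book_code W n M L c)"
  have "0 \<le> ?Q i xs" for i xs
    by (simp add: book_code_def sum_nonneg)
  moreover have "?Q i xs = 0" if "i < M" "xs \<notin> words n" for i xs
    using that c block_subset[of i M L] by (fastforce simp: book_code_def intro!: sum.neutral)
  moreover have "(\<Sum>xs\<in>words n. ?Q i xs) = 1" if "i < M" for i
  proof -
    have "(\<Sum>xs\<in>words n. ?Q i xs) = (\<Sum>k\<in>block L i. \<Sum>xs\<in>words n. of_bool (c k = xs)) / L"
      by (subst sum.swap) (simp add: book_code_def sum_divide_distrib)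
    also have "(\<Sum>k\<in>block L i. \<Sum>xs\<in>words n. of_bool (c k = xs) :: real) = (\<Sum>k\<in>block L i. 1)"
    proof (intro sum.cong refl)
      fix k assume "k \<in> block L i"
      then have k: "c k \<in> words n" using c that block_subset[of i M L] by auto
      show "(\<Sum>xs\<in>words n. of_bool (c k = xs) :: real) = 1"
        using k by (simp add: of_bool_def)
    qed
    finally show ?thesis using assms by simp
  qed
  ultimately show ?thesis
    using assms unfolding is_wtcode_def by (auto simp: book_code_def)
qed

text \<open>A wrong message entails a wrong index. Confusions inside a block are counted as well,
  which is why the total rate \<open>R + R'\<close> governs reliability.\<close>

lemma eps_B_book_code_le:
  assumes W: "channel W" and sizes: "1 \<le> M" "1 \<le> L" and c: "\<And>k. k < M * L \<Longrightarrow> c k \<in> words n"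
  shows "eps_B W n (book_code W n M L c)
    \<le> (\<Sum>k<M * L. \<Sum>ys\<in>words n. chan_ext W n (c k) ys *
        of_bool (\<exists>l<M * L. l \<noteq> k \<and> chan_ext W n (c k) ys \<le> chan_ext W n (c l) ys)) / real (M * L)"
proof -
  define V where "V k ys = chan_ext W n (c k) ys" for k ys
  define D where "D i = {ys \<in> words n. ml_decode W n (M * L) c ys div L = i}" for i
  have V0: "0 \<le> V k ys" for k ys unfolding V_def using W by (rule chan_ext_nonneg)
  have "eps_B W n (book_code W n M L c) = (\<Sum>i<M. \<Sum>ys\<in>words n - D i. (\<Sum>k\<in>block L i. V k ys) / L) / M"
    using c by (simp add: eps_B_def out_ext_book_code V_def) (simp add: book_code_def D_def)
  also have "(\<Sum>i<M. \<Sum>ys\<in>words n - D i. (\<Sum>k\<in>block L i. V k ys) / L)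
      = (\<Sum>i<M. \<Sum>k\<in>block L i. \<Sum>ys\<in>words n - D i. V k ys) / L"
    by (subst sum.swap) (simp add: sum_divide_distrib)
  also have "(\<Sum>i<M. \<Sum>k\<in>block L i. \<Sum>ys\<in>words n - D i. V k ys)
      \<le> (\<Sum>i<M. \<Sum>k\<in>block L i. \<Sum>ys\<in>words n. V k ys * of_bool (\<exists>l<M * L. l \<noteq> k \<and> V k ys \<le> V l ys))"
  proof (intro sum_mono)
    fix i k assume i: "i \<in> {..<M}" and k: "k \<in> block L i"
    have kN: "k < M * L" using i k block_subset[of i M L] by auto
    have "(\<Sum>ys\<in>words n - D i. V k ys)
        = (\<Sum>ys\<in>words n - D i. V k ys * of_bool (\<exists>l<M * L. l \<noteq> k \<and> V k ys \<le> V l ys))"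
    proof (intro sum.cong refl)
      fix ys assume ys: "ys \<in> words n - D i"
      have N: "0 < M * L" using sizes by simp
      have "ml_decode W n (M * L) c ys \<noteq> k"
        using ys block_div[OF k] by (auto simp: D_def)
      with ml_decode[OF N, where W = W and n = n and c = c and ys = ys] kN have "\<exists>l<M * L. l \<noteq> k \<and> V k ys \<le> V l ys"
        unfolding V_def by blast
      then show "V k ys = V k ys * of_bool (\<exists>l<M * L. l \<noteq> k \<and> V k ys \<le> V l ys)" by simp
    qed
    also have "\<dots> \<le> (\<Sum>ys\<in>words n. V k ys * of_bool (\<exists>l<M * L. l \<noteq> k \<and> V k ys \<le> V l ys))"
      using V0 by (intro sum_mono2) auto
    finally show "(\<Sum>ys\<in>words n - D i. V k ys)
        \<le> (\<Sum>ys\<in>words n. V k ys * of_bool (\<exists>l<M * L. l \<noteq> k \<and> V k ys \<le> V l ys))" .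
  qed
  finally show ?thesis
    unfolding sum_blocks V_def using sizes by (simp add: divide_right_mono mult.commute)
qed

text \<open>The averaged quantities \<open>F\<close> and \<open>G\<close> do not involve
  \<open>s\<close> or \<open>t\<close>, so one codebook is good for all parameters at once.
  Selection costs a factor 2; the 12 is this 2, times 2 from passing to \<open>d_E\<close>, times 3
  from the deviation bound.\<close>

lemma exists_wiretap_code:
  fixes WB :: "'a::finite \<Rightarrow> 'b::finite \<Rightarrow> real" and WE :: "'a \<Rightarrow> 'c::finite \<Rightarrow> real"
  assumes WB: "channel WB" and WE: "channel WE" and p: "distr p" and sizes: "1 \<le> M" "1 \<le> L"
  shows "\<exists>\<Phi> :: ('a, 'b) wtcode. is_wtcode n \<Phi> \<and> wc_M \<Phi> = M \<and>
    (\<forall>s\<in>{0..1}. eps_B WB n \<Phi> \<le> 2 * (real (M * L) powr s * exp (n * phi_fn s WB p))) \<and>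
    (\<forall>t\<in>{-1/2..0}. d_E WE n \<Phi> \<le> 12 * (real L powr t * exp (n * phi_fn t WE p)))"
proof -
  define N where "N = M * L"
  have N: "0 < N" using sizes by (simp add: N_def)
  interpret codebook "words n" "word_prob p n" N by (rule codebook_words[OF p])
  define F where "F c = (\<Sum>k<N. \<Sum>ys\<in>words n. chan_ext WB n (c k) ys *
      of_bool (\<exists>l<N. l \<noteq> k \<and> chan_ext WB n (c k) ys \<le> chan_ext WB n (c l) ys)) / N" for c
  define q where "q zs = mean (\<lambda>xs. chan_ext WE n xs zs)" for zs
  define G where "G c = (\<Sum>i<M. \<Sum>zs\<in>words n.
      \<bar>(\<Sum>k\<in>block L i. chan_ext WE n (c k) zs) / L - q zs\<bar>) / M" for c
  have EF: "expect F \<le> real N powr s * exp (n * phi_fn s WB p)" if s: "s \<in> {0..1}" for s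
  proof -
    have "expect F = (\<Sum>k<N. \<Sum>ys\<in>words n. expect (\<lambda>c. chan_ext WB n (c k) ys *
      of_bool (\<exists>l<N. l \<noteq> k \<and> chan_ext WB n (c k) ys \<le> chan_ext WB n (c l) ys))) / N"
      unfolding F_def by (simp only: expect_divide expect_sum)
    also have "\<dots> \<le> (\<Sum>k<N. \<Sum>ys\<in>words n. real N powr s *
        mean (\<lambda>xs. chan_ext WB n xs ys powr (1 / (1 + s))) powr (1 + s)) / N"
      using s chan_ext_nonneg[OF WB] by (intro divide_right_mono sum_mono expect_ml_error_le) auto
    also have "\<dots> = real N powr s * exp (n * phi_fn s WB p)"
      using N by (simp add: sum_words_mean_powr[OF WB p] flip: sum_distrib_left)
    finally show ?thesis .
  qed
  have EG: "expect G \<le> 3 * (real L powr t * exp (n * phi_fn t WE p))" if t: "t \<in> {-1/2..0}" for t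
  proof -
    have "expect G = (\<Sum>i<M. \<Sum>zs\<in>words n.
      expect (\<lambda>c. \<bar>(\<Sum>k\<in>block L i. chan_ext WE n (c k) zs) / L - q zs\<bar>)) / M"
      unfolding G_def by (simp only: expect_divide expect_sum)
    also have "\<dots> \<le> (\<Sum>i<M. \<Sum>zs\<in>words n. 3 * (real L powr t *
        mean (\<lambda>xs. chan_ext WE n xs zs powr (1 / (1 + t))) powr (1 + t))) / M"
      unfolding q_def using t chan_ext_nonneg[OF WE] sizes block_subset[of _ M L]
      by (intro divide_right_mono sum_mono expect_empirical_deviation_le) (auto simp: N_def)
    also have "\<dots> = 3 * (real L powr t * exp (n * phi_fn t WE p))"
      using sizes by (simp add: sum_words_mean_powr[OF WE p] flip: sum_distrib_left)
    finally show ?thesis .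
  qed
  obtain c where c: "c \<in> books" and Fc: "F c \<le> 2 * expect F" and Gc: "G c \<le> 2 * expect G"
    by (rule exists_good_book[of F G])
      (auto simp: F_def G_def intro!: divide_nonneg_nonneg sum_nonneg mult_nonneg_nonneg
         chan_ext_nonneg[OF WB])
  have cw: "c k \<in> words n" if "k < M * L" for k using books_mem[OF c] that by (simp add: N_def)
  define \<Phi> where "\<Phi> = book_code WB n M L c"
  have "eps_B WB n \<Phi> \<le> F c"
    using eps_B_book_code_le[OF WB sizes cw] by (simp add: \<Phi>_def F_def N_def)
  moreover have "d_E WE n \<Phi> \<le> 2 * G c"
    using d_E_le[of \<Phi> WE n q] sizes by (simp add: \<Phi>_def G_def out_ext_book_code cw)
  moreover have "is_wtcode n \<Phi>" unfolding \<Phi>_def using sizes cw by (rule is_wtcode_book_code)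
  moreover have "wc_M \<Phi> = M" by (simp add: \<Phi>_def)
  moreover have "eps_B WB n \<Phi> \<le> 2 * (real (M * L) powr s * exp (n * phi_fn s WB p))"
    if "s \<in> {0..1}" for s
    using EF[OF that] Fc calculation(1) unfolding N_def by linarith
  moreover have "d_E WE n \<Phi> \<le> 12 * (real L powr t * exp (n * phi_fn t WE p))"
    if "t \<in> {-1/2..0}" for t
    using EG[OF that] Gc calculation(2) by linarith
  ultimately show ?thesis by blast
qed

section \<open>Exponents\<close>

text \<open>Jensen's inequality for the power \<open>1 / (1 + s)\<close> under the output law of
  \<open>p\<close>.\<close>

lemma phi_fn_le_psi_fn:
  assumes W: "channel W" and p: "distr p" and s: "0 \<le> s"
  shows "phi_fn (- s / (1 + s)) W p \<le> psi_fn s W p / (1 + s)"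
proof -
  define t where "t = - s / (1 + s)"
  define r where "r = 1 / (1 + s)"
  have r: "0 \<le> r" "r \<le> 1" "1 + t = r" "1 / (1 + t) = 1 + s" "(1 + s) * r = 1"
    using s by (auto simp: t_def r_def field_simps)
  have p0: "0 \<le> p x" and W0: "0 \<le> W x y" for x y
    using W p by (auto simp: channel_def distr_def)
  define q where "q = out1 W p"
  define g where "g y = (\<Sum>x\<in>UNIV. p x * W x y powr (1 + s))" for y
  \<comment> \<open>Chosen so that \<open>q y * u y powr r\<close> is the summand of
    \<open>phi_fn\<close>, while the mean of \<open>u\<close> under \<open>q\<close> is the argument
    of the logarithm in \<open>psi_fn\<close>. Where \<open>q y = 0\<close>, also
    \<open>g y = 0\<close>, so both identities survive.\<close>
  define u where "u y = g y * q y powr (- (1 + s))" for y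
  define H where "H = (\<Sum>x\<in>UNIV. p x * (\<Sum>y\<in>UNIV. W x y powr (1 + s) * q y powr (- s)))"
  have q0: "0 \<le> q y" for y unfolding q_def out1_def using p0 W0 by (intro sum_nonneg) auto
  have g0: "0 \<le> g y" for y unfolding g_def using p0 by (intro sum_nonneg) auto
  have u0: "0 \<le> u y" for y unfolding u_def using g0 by simp
  have gq: "g y = 0" if "q y = 0" for y
  proof -
    have "\<forall>x. p x * W x y = 0"
      using that p0 W0 unfolding q_def out1_def by (subst (asm) sum_nonneg_eq_0_iff) auto
    then show ?thesis unfolding g_def by (intro sum.neutral) auto
  qed
  have q1: "(\<Sum>y\<in>UNIV. q y) = 1"
  proof -
    have "(\<Sum>y\<in>UNIV. q y) = (\<Sum>x\<in>UNIV. \<Sum>y\<in>UNIV. p x * W x y)"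
      unfolding q_def out1_def by (rule sum.swap)
    also have "\<dots> = 1" using W p by (simp add: channel_def distr_def flip: sum_distrib_left)
    finally show ?thesis .
  qed
  have qur: "q y * u y powr r = g y powr r" for y
  proof (cases "q y = 0")
    case False
    then have "0 < q y" using q0[of y] by simp
    moreover have "(- 1 - s) * r = - 1" using r(5) by (simp add: algebra_simps)
    ultimately show ?thesis using g0
      by (simp add: u_def powr_mult powr_powr powr_minus_divide)
  qed (simp add: gq)
  have qu: "q y * u y = (\<Sum>x\<in>UNIV. p x * (W x y powr (1 + s) * q y powr (- s)))" for y
  proof -
    have "q y * q y powr (- (1 + s)) = q y powr (- s)"
      using q0[of y] by (simp add: powr_mult_base)
    then have "q y * u y = g y * q y powr (- s)" by (simp add: u_def algebra_simps)
    also have "\<dots> = (\<Sum>x\<in>UNIV. p x * (W x y powr (1 + s) * q y powr (- s)))"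
      unfolding g_def sum_distrib_right by (simp add: mult.assoc)
    finally show ?thesis .
  qed
  have H: "H = (\<Sum>y\<in>UNIV. q y * u y)"
    unfolding H_def qu by (simp add: sum_distrib_left) (rule sum.swap)
  have G: "0 < (\<Sum>y\<in>UNIV. g y powr r)"
    using phi_fn_arg_pos[OF W p, of t] r by (simp add: g_def)
  have "H \<noteq> 0"
  proof
    assume "H = 0"
    then have "\<forall>y. q y * u y = 0"
      unfolding H using q0 u0 by (subst (asm) sum_nonneg_eq_0_iff) auto
    then have "\<forall>y. q y * u y powr r = 0" by auto
    with G show False by (simp add: qur)
  qed
  moreover have "0 \<le> H" unfolding H using q0 u0 by (intro sum_nonneg) auto
  ultimately have H0: "0 < H" by simp
  have "(\<Sum>y\<in>UNIV. g y powr r) \<le> H powr r"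
    using weighted_sum_powr_le[of r UNIV q u] r q0 u0 q1 H0 by (simp add: H qur)
  then have "ln (\<Sum>y\<in>UNIV. g y powr r) \<le> ln (H powr r)" using G by (intro ln_mono) auto
  also have "\<dots> = ln H / (1 + s)" using H0 by (simp add: ln_powr r_def)
  finally show ?thesis
    unfolding t_def[symmetric] phi_fn_def psi_fn_def r(3)
    by (simp add: g_def H_def q_def r(4)[unfolded r(3)])
qed

section \<open>From bounds at each block length to exponents\<close>

text \<open>A prefactor affine in \<open>n\<close> disappears on the exponential scale; affine
  growth is allowed for the sake of the factor \<open>1 + ln M\<close> in the bound on
  \<open>I_E\<close>.\<close>

lemma liminf_exprate_ge:
  fixes a :: "nat \<Rightarrow> real"
  assumes a: "\<And>n. 0 \<le> a n" and le: "\<And>n. a n \<le> (A + B * n) * exp (n * (- x))"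
    and A: "0 < A" and B: "0 \<le> B"
  shows "ereal x \<le> liminf (\<lambda>n. exprate n (a n))"
proof -
  have "(\<lambda>n. x - ln (A + B * real n) / real n) \<longlonglongrightarrow> x"
  proof (cases "B = 0")
    case True
    then show ?thesis by simp real_asymp
  next
    case False
    with B have "0 < B" by simp
    with A show ?thesis by real_asymp
  qed
  then have "(\<lambda>n. ereal (x - ln (A + B * real n) / real n)) \<longlonglongrightarrow> ereal x" by simp
  then have "ereal x = liminf (\<lambda>n. ereal (x - ln (A + B * real n) / real n))"
    by (intro lim_imp_Liminf[symmetric]) auto
  also have "\<dots> \<le> liminf (\<lambda>n. exprate n (a n))"
  proof (rule Liminf_mono)
    show "\<forall>\<^sub>F n in sequentially. ereal (x - ln (A + B * real n) / real n) \<le> exprate n (a n)"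
    proof (rule eventually_mono[OF eventually_gt_at_top[of 0]])
      fix n :: nat assume n: "0 < n"
      show "ereal (x - ln (A + B * real n) / real n) \<le> exprate n (a n)"
      proof (cases "a n = 0")
        case True
        then show ?thesis by (simp add: exprate_def)
      next
        case False
        then have an: "0 < a n" using a[of n] by simp
        have AB: "0 < A + B * n" using A B by (intro add_pos_nonneg) auto
        have "ln (a n) \<le> ln ((A + B * n) * exp (n * (- x)))"
          using le[of n] an by (intro ln_mono) auto
        also have "\<dots> = ln (A + B * n) - n * x" using AB by (simp add: ln_mult)
        finally have "ln (a n) / n \<le> (ln (A + B * n) - n * x) / n" by (rule divide_right_mono) simp
        then show ?thesis using False n by (simp add: exprate_def diff_divide_distrib)
      qed
    qed
  qed
  finally show ?thesis .
qed

text \<open>Rounding up adds less than 1, which is at most \<open>exp x\<close> because the rate is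
  nonnegative.\<close>

lemma nat_ceiling_exp_bounds:
  fixes x :: real
  assumes "0 \<le> x"
  shows "exp x \<le> real (nat \<lceil>exp x\<rceil>)" "real (nat \<lceil>exp x\<rceil>) \<le> 2 * exp x" "1 \<le> nat \<lceil>exp x\<rceil>"
proof -
  have 1: "1 \<le> exp x" using assms by simp
  show "exp x \<le> real (nat \<lceil>exp x\<rceil>)" by (rule real_nat_ceiling_ge)
  show "real (nat \<lceil>exp x\<rceil>) \<le> 2 * exp x" using 1 by linarith
  show "1 \<le> nat \<lceil>exp x\<rceil>" using 1 by linarith
qed

theorem theorem11:
  fixes WB :: "'a::finite \<Rightarrow> 'b::finite \<Rightarrow> real"
    and WE :: "'a \<Rightarrow> 'c::finite \<Rightarrow> real"
    and R R' :: real and p :: "'a \<Rightarrow> real"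
  assumes "channel WB" and "channel WE"
    and "0 \<le> R" and "0 \<le> R'" and "distr p"
  shows "\<exists>\<Phi> :: nat \<Rightarrow> ('a, 'b) wtcode.
     (\<forall>n. is_wtcode n (\<Phi> n)) \<and>
     (\<lambda>n. ln (real (wc_M (\<Phi> n))) / real n) \<longlonglongrightarrow> R \<and>
     liminf (\<lambda>n. exprate n (eps_B WB n (\<Phi> n)))
        \<ge> (SUP s\<in>{0..1}. ereal (- phi_fn s WB p - s * (R + R'))) \<and>
     liminf (\<lambda>n. exprate n (I_E WE n (\<Phi> n)))
        \<ge> (SUP t\<in>{-1/2..0}. ereal (- phi_fn t WE p - t * R')) \<and>
     liminf (\<lambda>n. exprate n (d_E WE n (\<Phi> n)))
        \<ge> (SUP s\<in>{0..1}. ereal ((- psi_fn s WE p + s * R') / (1 + s))) \<and>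
     liminf (\<lambda>n. exprate n (d_E WE n (\<Phi> n)))
        \<ge> ereal (1/2) * (SUP t\<in>{-1/2..0}. ereal (- phi_fn t WE p - t * R'))"
proof -
  note WB = assms(1) and WE = assms(2) and R = assms(3) and R' = assms(4) and p = assms(5)
  define M where "M n = nat \<lceil>exp (real n * R)\<rceil>" for n
  define L where "L n = nat \<lceil>exp (real n * R')\<rceil>" for n
  have "0 \<le> real n * R" "0 \<le> real n * R'" for n using R R' by simp_all
  note Mb = nat_ceiling_exp_bounds[OF this(1), folded M_def]
    and Lb = nat_ceiling_exp_bounds[OF this(2), folded L_def]
  have "\<forall>n. \<exists>\<Phi> :: ('a, 'b) wtcode. is_wtcode n \<Phi> \<and> wc_M \<Phi> = M n \<and>
    (\<forall>s\<in>{0..1}. eps_B WB n \<Phi> \<le> 2 * (real (M n * L n) powr s * exp (n * phi_fn s WB p))) \<and>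
    (\<forall>t\<in>{-1/2..0}. d_E WE n \<Phi> \<le> 12 * (real (L n) powr t * exp (n * phi_fn t WE p)))"
    using exists_wiretap_code[OF WB WE p Mb(3) Lb(3)] by blast
  then obtain \<Phi> :: "nat \<Rightarrow> ('a, 'b) wtcode" where
    code: "\<And>n. is_wtcode n (\<Phi> n)" and wcM: "\<And>n. wc_M (\<Phi> n) = M n" and
    eps: "\<And>n s. s \<in> {0..1} \<Longrightarrow>
      eps_B WB n (\<Phi> n) \<le> 2 * (real (M n * L n) powr s * exp (n * phi_fn s WB p))" and
    dE: "\<And>n t. t \<in> {-1/2..0} \<Longrightarrow>
      d_E WE n (\<Phi> n) \<le> 12 * (real (L n) powr t * exp (n * phi_fn t WE p))"
    by metis
  have lnM: "n * R \<le> ln (M n)" "ln (M n) \<le> 1 + n * R" for n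
  proof -
    have "ln (exp (n * R)) \<le> ln (real (M n))" using Mb(1)[of n] by (intro ln_mono) auto
    then show "n * R \<le> ln (M n)" by simp
    have "ln (real (M n)) \<le> ln (2 * exp (n * R))" using Mb(2,3)[of n] by (intro ln_mono) auto
    also have "\<dots> = ln 2 + n * R" by (simp add: ln_mult)
    also have "\<dots> \<le> 1 + n * R" using ln_2_less_1 by simp
    finally show "ln (M n) \<le> 1 + n * R" .
  qed
  have rate: "(\<lambda>n. ln (real (wc_M (\<Phi> n))) / real n) \<longlonglongrightarrow> R"
  proof (rule tendsto_sandwich)
    show "\<forall>\<^sub>F n in sequentially. R \<le> ln (real (wc_M (\<Phi> n))) / real n"
      using eventually_gt_at_top[of 0]
      by eventually_elim (use lnM(1) in \<open>simp add: wcM field_simps\<close>)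
    show "\<forall>\<^sub>F n in sequentially. ln (real (wc_M (\<Phi> n))) / real n \<le> 1 / real n + R"
      using eventually_gt_at_top[of 0]
      by eventually_elim (use lnM(2) in \<open>simp add: wcM field_simps\<close>)
    show "(\<lambda>n. 1 / real n + R) \<longlonglongrightarrow> R" by real_asymp
  qed auto
  have epsR: "ereal (- phi_fn s WB p - s * (R + R')) \<le> liminf (\<lambda>n. exprate n (eps_B WB n (\<Phi> n)))"
    if s: "s \<in> {0..1}" for s
  \<comment> \<open>Rounding both \<open>M\<close> and \<open>L\<close> costs
    \<open>4 powr s \<le> 4\<close>, and the selection of the codebook costs 2.\<close>
  proof (rule liminf_exprate_ge[where A = 8 and B = 0])
    fix n :: nat
    show "0 \<le> eps_B WB n (\<Phi> n)" using WB code by (rule eps_B_nonneg)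
    have "real (M n * L n) \<le> (2 * exp (n * R)) * (2 * exp (n * R'))"
      unfolding of_nat_mult using Mb(2) Lb(2) by (intro mult_mono) auto
    also have "\<dots> = 4 * exp (n * (R + R'))" by (simp add: exp_add algebra_simps)
    finally have "real (M n * L n) powr s \<le> (4 * exp (n * (R + R'))) powr s"
      using s by (intro powr_mono2) auto
    also have "\<dots> = 4 powr s * exp (n * (s * (R + R')))"
      by (simp add: powr_mult exp_powr_real algebra_simps)
    also have "\<dots> \<le> 4 * exp (n * (s * (R + R')))"
      using s powr_mono[of s 1 4] by (intro mult_right_mono) auto
    finally have "real (M n * L n) powr s * exp (n * phi_fn s WB p)
        \<le> 4 * exp (n * (s * (R + R'))) * exp (n * phi_fn s WB p)"
      by (intro mult_right_mono) auto
    then have "eps_B WB n (\<Phi> n) \<le> 8 * (exp (n * (s * (R + R'))) * exp (n * phi_fn s WB p))"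
      using eps[OF s, of n] by linarith
    then show "eps_B WB n (\<Phi> n) \<le> (8 + 0 * real n) * exp (n * (- (- phi_fn s WB p - s * (R + R'))))"
      by (simp add: algebra_simps flip: exp_add)
  qed auto
  have dE': "d_E WE n (\<Phi> n) \<le> 12 * exp (n * (- (- phi_fn t WE p - t * R')))"
    if t: "t \<in> {-1/2..0}" for n t
  proof -
    \<comment> \<open>The exponent is nonpositive, so the lower bound on \<open>L n\<close> is the
      relevant one and rounding costs nothing.\<close>
    have "real (L n) powr t \<le> exp (n * R') powr t"
      using t Lb(1)[of n] by (intro powr_mono2') auto
    also have "\<dots> = exp (n * (t * R'))" by (simp add: exp_powr_real algebra_simps)
    finally have "real (L n) powr t * exp (n * phi_fn t WE p) \<le> exp (n * (t * R')) * exp (n * phi_fn t WE p)"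
      by (intro mult_right_mono) auto
    then show ?thesis using dE[OF t, of n] by (simp add: algebra_simps flip: exp_add)
  qed
  have d0: "0 \<le> d_E WE n (\<Phi> n)" for n
    using Mb(3) wcM by (intro d_E_nonneg) simp
  have dR: "ereal (- phi_fn t WE p - t * R') \<le> liminf (\<lambda>n. exprate n (d_E WE n (\<Phi> n)))"
    if "t \<in> {-1/2..0}" for t
    using dE'[OF that] d0 by (intro liminf_exprate_ge[where A = 12 and B = 0]) auto
  have IR: "ereal (- phi_fn t WE p - t * R') \<le> liminf (\<lambda>n. exprate n (I_E WE n (\<Phi> n)))"
    if t: "t \<in> {-1/2..0}" for t
  \<comment> \<open>The prefactor is 12 times the bound \<open>2 + n * R\<close> for
    \<open>1 + ln (M n)\<close>.\<close>
  proof (rule liminf_exprate_ge[where A = 24 and B = "12 * R"])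
    fix n :: nat
    show "0 \<le> I_E WE n (\<Phi> n)" using WE code by (rule I_E_nonneg)
    have "I_E WE n (\<Phi> n) \<le> (1 + ln (M n)) * d_E WE n (\<Phi> n)"
      using I_E_le[OF WE code] by (simp add: wcM)
    also have "\<dots> \<le> (2 + n * R) * (12 * exp (n * (- (- phi_fn t WE p - t * R'))))"
      using lnM[of n] dE'[OF t, of n] d0 R by (intro mult_mono) auto
    finally show "I_E WE n (\<Phi> n) \<le> (24 + 12 * R * real n) * exp (n * (- (- phi_fn t WE p - t * R')))"
      by (simp add: algebra_simps)
  qed (use R in auto)
  have psiR: "ereal ((- psi_fn s WE p + s * R') / (1 + s)) \<le> liminf (\<lambda>n. exprate n (d_E WE n (\<Phi> n)))"
    if s: "s \<in> {0..1}" for s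
  proof -
    \<comment> \<open>This maps the range of \<open>s\<close> into that of \<open>t\<close> and
      turns \<open>s * R' / (1 + s)\<close> into \<open>- t * R'\<close>.\<close>
    define t where "t = - s / (1 + s)"
    have t: "t \<in> {-1/2..0}" using s by (auto simp: t_def field_simps)
    have "(- psi_fn s WE p + s * R') / (1 + s) = - (psi_fn s WE p / (1 + s)) - t * R'"
      by (simp add: t_def add_divide_distrib diff_divide_distrib)
    also have "\<dots> \<le> - phi_fn t WE p - t * R'"
      using phi_fn_le_psi_fn[OF WE p, of s] s by (simp add: t_def)
    finally show ?thesis using dR[OF t] by (meson ereal_less_eq(3) order_trans)
  qed
  define S where "S = (SUP t\<in>{-1/2..0}. ereal (- phi_fn t WE p - t * R'))"
  have dS: "S \<le> liminf (\<lambda>n. exprate n (d_E WE n (\<Phi> n)))"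
    unfolding S_def by (rule SUP_least) (rule dR)
  have "phi_fn 0 WE p = 0"
  proof -
    have 0: "0 \<le> p x" "0 \<le> WE x y" for x y using WE p by (auto simp: channel_def distr_def)
    have "(\<Sum>y\<in>UNIV. (\<Sum>x\<in>UNIV. p x * WE x y powr 1) powr 1) = (\<Sum>y\<in>UNIV. \<Sum>x\<in>UNIV. p x * WE x y)"
      using 0 by (simp add: sum_nonneg)
    also have "\<dots> = (\<Sum>x\<in>UNIV. \<Sum>y\<in>UNIV. p x * WE x y)" by (rule sum.swap)
    also have "\<dots> = 1" using WE p by (simp add: channel_def distr_def flip: sum_distrib_left)
    finally show ?thesis by (simp add: phi_fn_def)
  qed
  then have S0: "0 \<le> S"
    unfolding S_def by (intro SUP_upper2[of 0]) (auto simp: zero_ereal_def)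
  have "ereal (1/2) * S \<le> 1 * S"
    using S0 by (intro ereal_mult_right_mono) (auto simp: one_ereal_def)
  also have "\<dots> \<le> liminf (\<lambda>n. exprate n (d_E WE n (\<Phi> n)))" using dS by simp
  finally have half: "ereal (1/2) * S \<le> liminf (\<lambda>n. exprate n (d_E WE n (\<Phi> n)))" .
  show ?thesis
    using code rate epsR IR psiR half unfolding S_def
    by (intro exI[of _ \<Phi>] conjI SUP_least allI) auto
qed

end
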